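(* Let $\Gamma=(\pi,\mathcal{C},\Sigma)$ be a concrete data type definition and $\mathcal{E}$ a finite set of equations between terms of sort $\pi$ having a complete presentation $\mathcal{R}$. Fix a function $\mathrm{orient}$ assigning to each associative-commutative constructor a kind of comb (left or right) and a total ordering $\le$ on terms. Let $\mathcal{F}=(f_C)_{C\in\mathcal{C}}$ be a family of construction functions such that, for all $C:\sigma_1\ldots\sigma_n\pi$ and all $v_i\in\mathrm{Val}(\sigma_i)$, $f_C(v_1,\ldots,v_n)$ is an $\mathcal{R},AC$-normal form of $C(v_1,\ldots,v_n)$ that is in AC-normal form with respect to $\mathrm{orient}$ and $\le$. Then $\mathcal{F}$ is valid with respect to $\mathcal{E}$.
   Context: Fix primitive sorts $\mathcal{S}_0$ and primitive constants $\mathcal{C}_0$. A concrete data type definition is $\Gamma=(\pi,\mathcal{C},\Sigma)$ with $\pi\notin\mathcal{S}_0$, $\mathcal{C}$ a non-empty set of constructors, and profiles $C:\sigma_1\ldots\sigma_n\pi$ with $\sigma_i\in\mathcal{S}_0\cup\{\pi\}$. $\mathcal{T}_\sigma$ is the set of variable-free terms of sort $\sigma$ over $\mathcal{C}_0\cup\mathcal{C}$. $=_\mathcal{E}$ is the smallest congruence containing $\mathcal{E}$ (closed under substitution and contexts). A family of construction functions is $(f_C)$ with $f_C:\mathcal{T}_{\sigma_1}\times\cdots\times\mathcal{T}_{\sigma_n}\to\mathcal{T}_\pi$; values: $\mathrm{Val}(\sigma)=\mathcal{T}_\sigma$ for primitive $\sigma$, and $\mathrm{Val}(\pi)$ is the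 smallest set containing $f_C(v_1,\ldots,v_n)$ for all $C$ and $v_i\in\mathrm{Val}(\sigma_i)$. The family is valid w.r.t. $\mathcal{E}$ if (correctness) $f_C(v_1,\ldots,v_n)=_\mathcal{E}C(v_1,\ldots,v_n)$ for all $C$ and values $v_i$, and (completeness) $C(v_1,\ldots,v_n)=_\mathcal{E}D(w_1,\ldots,w_p)$ with $v_i,w_j$ values implies $f_C(v_1,\ldots,v_n)=f_D(w_1,\ldots,w_p)$ syntactically. A constructor $C$ is commutative if $\mathcal{E}$ contains $C(x,y)=C(y,x)$; it is an AC-constructor if moreover $\mathcal{E}$ contains its associativity equation. $\mathcal{E}_{AC}$ is the subset of $\mathcal{E}$ made of commutativity and associativity equations of commutative constructors, $=_{AC}$ the congruence it generates, $\mathcal{E}_{\neg AC}=\mathcal{E}\setminus\mathcal{E}_{AC}$. For rules $\mathcal{R}$, $t\to_{\mathcal{R},AC}u$ iff $t|_p=_{AC}l\theta$ and $u=t[r\theta]_p$ for some position $p$, rule $l\to r\in\mathcal{R}$, substitution $\theta$. An $\mathcal{R},AC$-normal form of $t$ is a term $u$ with $t\to^*_{\mathcal{R},AC}u$ and $u$ not $\to_{\mathcal{R},AC}$-reducible. $\mathcal{E}$ has complete presentation $\mathcal{R}$ if $\mathcal{R}$ is a finite set of rules contained in some AC-compatible reduction ordering (well-founded, stable under contexts and substitutions, invariant under $=_{AC}$ on both sides), $\to_{\mathcal{R},AC}$ is confluent modulo AC (i.e. ${}^*_{\mathcal{R},AC}\!\!\leftarrow\,=_{AC}\,\to^*_{\mathcal{R},AC}\;\subseteq\;\to^*_{\mathcal{R},AC}\,=_{AC}\,{}^*_{\mathcal{R},AC}\!\!\leftarrow$),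 and $=_\mathcal{E}$ equals the congruence generated by $\mathcal{R}\cup\mathcal{E}_{AC}$. AC-normal forms: for an AC-constructor $C$, a term not headed by $C$ is both a $C$-left-comb and a $C$-right-comb with leaves $[t]$; if $t$ is not headed by $C$ and $u$ is a $C$-right-comb then $C(t,u)$ is a $C$-right-comb with leaves $t$ followed by the leaves of $u$; if $t$ is not headed by $C$ and $u$ is a $C$-left-comb then $C(u,t)$ is a $C$-left-comb with leaves those of $u$ followed by $t$. A term $t$ is in AC-normal form w.r.t. $\mathrm{orient}$ and $\le$ if every subterm of $t$ headed by an AC-constructor $C$ is an $\mathrm{orient}(C)$-comb whose leaves are in increasing order w.r.t. $\le$, and every subterm $C(u,v)$ with $C$ commutative but not associative satisfies $u\le v$. *)

theory Defs
  imports Main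
begin

text \<open>Variables carry their sort, so that every sort has infinitely many of them.\<close>

datatype ('s, 'k, 'c) trm =
    Var nat 's
  | Prim 'k
  | Con 'c "('s, 'k, 'c) trm list"

text \<open>The target sort of every constructor is \<open>data_sort\<close>; \<open>profile\<close> only lists the argument sorts.\<close>

record ('s, 'k, 'c) cdt =
  prim_sorts :: "'s set"
  prim_consts :: "'k set"
  const_sort :: "'k \<Rightarrow> 's"
  data_sort :: 's
  constrs :: "'c set"
  profile :: "'c \<Rightarrow> 's list"

definition sorts :: "('s, 'k, 'c) cdt \<Rightarrow> 's set" where
  "sorts \<Gamma> = insert (data_sort \<Gamma>) (prim_sorts \<Gamma>)"

definition cdt_definition :: "('s, 'k, 'c) cdt \<Rightarrow> bool" where
  "cdt_definition \<Gamma> \<longleftrightarrow>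
     const_sort \<Gamma> ` prim_consts \<Gamma> \<subseteq> prim_sorts \<Gamma> \<and>
     data_sort \<Gamma> \<notin> prim_sorts \<Gamma> \<and>
     constrs \<Gamma> \<noteq> {} \<and>
     (\<forall>C\<in>constrs \<Gamma>. set (profile \<Gamma> C) \<subseteq> sorts \<Gamma>)"

inductive has_sort :: "('s, 'k, 'c) cdt \<Rightarrow> 's \<Rightarrow> ('s, 'k, 'c) trm \<Rightarrow> bool" for \<Gamma> where
  Var: "\<sigma> \<in> sorts \<Gamma> \<Longrightarrow> has_sort \<Gamma> \<sigma> (Var x \<sigma>)"
| Prim: "k \<in> prim_consts \<Gamma> \<Longrightarrow> has_sort \<Gamma> (const_sort \<Gamma> k) (Prim k)"
| Con: "C \<in> constrs \<Gamma> \<Longrightarrow> list_all2 (has_sort \<Gamma>) (profile \<Gamma> C) ts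
    \<Longrightarrow> has_sort \<Gamma> (data_sort \<Gamma>) (Con C ts)"

definition well_sorted :: "('s, 'k, 'c) cdt \<Rightarrow> ('s, 'k, 'c) trm set" where
  "well_sorted \<Gamma> = {t. \<exists>\<sigma>. has_sort \<Gamma> \<sigma> t}"

primrec vars :: "('s, 'k, 'c) trm \<Rightarrow> (nat \<times> 's) set" where
  "vars (Var x \<sigma>) = {(x, \<sigma>)}"
| "vars (Prim k) = {}"
| "vars (Con C ts) = \<Union> (set (map vars ts))"

definition ground :: "('s, 'k, 'c) cdt \<Rightarrow> 's \<Rightarrow> ('s, 'k, 'c) trm set" where
  "ground \<Gamma> \<sigma> = {t. has_sort \<Gamma> \<sigma> t \<and> vars t = {}}"

type_synonym ('s, 'k, 'c) sbst = "nat \<Rightarrow> 's \<Rightarrow> ('s, 'k, 'c) trm"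

primrec app_sbst :: "('s, 'k, 'c) sbst \<Rightarrow> ('s, 'k, 'c) trm \<Rightarrow> ('s, 'k, 'c) trm" where
  "app_sbst \<theta> (Var x \<sigma>) = \<theta> x \<sigma>"
| "app_sbst \<theta> (Prim k) = Prim k"
| "app_sbst \<theta> (Con C ts) = Con C (map (app_sbst \<theta>) ts)"

definition sorted_sbst :: "('s, 'k, 'c) cdt \<Rightarrow> ('s, 'k, 'c) sbst \<Rightarrow> bool" where
  "sorted_sbst \<Gamma> \<theta> \<longleftrightarrow> (\<forall>x. \<forall>\<sigma>\<in>sorts \<Gamma>. has_sort \<Gamma> \<sigma> (\<theta> x \<sigma>))"

primrec positions :: "('s, 'k, 'c) trm \<Rightarrow> nat list set" where
  "positions (Var x \<sigma>) = {[]}"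
| "positions (Prim k) = {[]}"
| "positions (Con C ts) =
     insert [] {i # p |i p. i < length ts \<and> p \<in> map positions ts ! i}"

text \<open>The next two functions are only meaningful for \<open>p \<in> positions t\<close>.\<close>

fun subterm_at :: "('s, 'k, 'c) trm \<Rightarrow> nat list \<Rightarrow> ('s, 'k, 'c) trm" where
  "subterm_at t [] = t"
| "subterm_at (Con C ts) (i # p) = subterm_at (ts ! i) p"
| "subterm_at t (i # p) = t"

fun replace_at :: "('s, 'k, 'c) trm \<Rightarrow> nat list \<Rightarrow> ('s, 'k, 'c) trm \<Rightarrow> ('s, 'k, 'c) trm" where
  "replace_at t [] s = s"
| "replace_at (Con C ts) (i # p) s = Con C (ts[i := replace_at (ts ! i) p s])"
| "replace_at t (i # p) s = t"

definition subterms :: "('s, 'k, 'c) trm \<Rightarrow> ('s, 'k, 'c) trm set" where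
  "subterms t = subterm_at t ` positions t"

text \<open>The congruence lives on all well-sorted terms, including those with variables.\<close>

inductive_set eq_cong ::
    "('s, 'k, 'c) cdt \<Rightarrow> ('s, 'k, 'c) trm rel \<Rightarrow> ('s, 'k, 'c) trm rel" for \<Gamma> E where
  base: "e \<in> E \<Longrightarrow> e \<in> eq_cong \<Gamma> E"
| refl: "t \<in> well_sorted \<Gamma> \<Longrightarrow> (t, t) \<in> eq_cong \<Gamma> E"
| sym: "(t, u) \<in> eq_cong \<Gamma> E \<Longrightarrow> (u, t) \<in> eq_cong \<Gamma> E"
| trans: "(t, u) \<in> eq_cong \<Gamma> E \<Longrightarrow> (u, v) \<in> eq_cong \<Gamma> E \<Longrightarrow> (t, v) \<in> eq_cong \<Gamma> E"
| sbst: "(t, u) \<in> eq_cong \<Gamma> E \<Longrightarrow> sorted_sbst \<Gamma> \<theta>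
    \<Longrightarrow> (app_sbst \<theta> t, app_sbst \<theta> u) \<in> eq_cong \<Gamma> E"
| ctxt: "(t, u) \<in> eq_cong \<Gamma> E
    \<Longrightarrow> Con C (ss @ t # ts) \<in> well_sorted \<Gamma> \<Longrightarrow> Con C (ss @ u # ts) \<in> well_sorted \<Gamma>
    \<Longrightarrow> (Con C (ss @ t # ts), Con C (ss @ u # ts)) \<in> eq_cong \<Gamma> E"

text \<open>
  Equations are read up to the names of their variables and, for associativity, up to the
  orientation of the pair.
\<close>

definition comm_eq :: "'c \<Rightarrow> ('s, 'k, 'c) trm \<times> ('s, 'k, 'c) trm \<Rightarrow> bool" where
  "comm_eq C e \<longleftrightarrow> (\<exists>x y \<sigma>. x \<noteq> y \<and>
     e = (Con C [Var x \<sigma>, Var y \<sigma>], Con C [Var y \<sigma>, Var x \<sigma>]))"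

definition assoc_eq :: "'c \<Rightarrow> ('s, 'k, 'c) trm \<times> ('s, 'k, 'c) trm \<Rightarrow> bool" where
  "assoc_eq C e \<longleftrightarrow> (\<exists>x y z \<sigma> l r. distinct [x, y, z] \<and>
     l = Con C [Con C [Var x \<sigma>, Var y \<sigma>], Var z \<sigma>] \<and>
     r = Con C [Var x \<sigma>, Con C [Var y \<sigma>, Var z \<sigma>]] \<and>
     (e = (l, r) \<or> e = (r, l)))"

definition commutative :: "('s, 'k, 'c) trm rel \<Rightarrow> 'c \<Rightarrow> bool" where
  "commutative E C \<longleftrightarrow> (\<exists>e\<in>E. comm_eq C e)"

definition AC_constr :: "('s, 'k, 'c) trm rel \<Rightarrow> 'c \<Rightarrow> bool" where
  "AC_constr E C \<longleftrightarrow> commutative E C \<and> (\<exists>e\<in>E. assoc_eq C e)"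

definition AC_part :: "('s, 'k, 'c) trm rel \<Rightarrow> ('s, 'k, 'c) trm rel" where
  "AC_part E = {e \<in> E. \<exists>C. commutative E C \<and> (comm_eq C e \<or> assoc_eq C e)}"

abbreviation AC_cong ::
    "('s, 'k, 'c) cdt \<Rightarrow> ('s, 'k, 'c) trm rel \<Rightarrow> ('s, 'k, 'c) trm rel" where
  "AC_cong \<Gamma> E \<equiv> eq_cong \<Gamma> (AC_part E)"

definition AC_step :: "('s, 'k, 'c) cdt \<Rightarrow> ('s, 'k, 'c) trm rel \<Rightarrow> ('s, 'k, 'c) trm rel
    \<Rightarrow> ('s, 'k, 'c) trm rel" where
  "AC_step \<Gamma> E R = {(t, u). t \<in> well_sorted \<Gamma> \<and>
     (\<exists>p\<in>positions t. \<exists>(l, r)\<in>R. \<exists>\<theta>. sorted_sbst \<Gamma> \<theta> \<and>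
        (subterm_at t p, app_sbst \<theta> l) \<in> AC_cong \<Gamma> E \<and>
        u = replace_at t p (app_sbst \<theta> r))}"

definition R_AC_normal_form_of :: "('s, 'k, 'c) cdt \<Rightarrow> ('s, 'k, 'c) trm rel
    \<Rightarrow> ('s, 'k, 'c) trm rel \<Rightarrow> ('s, 'k, 'c) trm \<Rightarrow> ('s, 'k, 'c) trm \<Rightarrow> bool" where
  "R_AC_normal_form_of \<Gamma> E R u t \<longleftrightarrow>
     (t, u) \<in> (AC_step \<Gamma> E R)\<^sup>* \<and> u \<notin> Domain (AC_step \<Gamma> E R)"

text \<open>In \<open>(t, u) \<in> gt\<close> the larger term is \<open>t\<close>.\<close>

definition AC_reduction_ordering ::
    "('s, 'k, 'c) cdt \<Rightarrow> ('s, 'k, 'c) trm rel \<Rightarrow> ('s, 'k, 'c) trm rel \<Rightarrow> bool" where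
  "AC_reduction_ordering \<Gamma> E gt \<longleftrightarrow>
     gt \<subseteq> well_sorted \<Gamma> \<times> well_sorted \<Gamma> \<and> trans gt \<and> wf (gt\<inverse>) \<and>
     (\<forall>t u C ss ts. (t, u) \<in> gt \<longrightarrow> Con C (ss @ t # ts) \<in> well_sorted \<Gamma>
        \<longrightarrow> Con C (ss @ u # ts) \<in> well_sorted \<Gamma>
        \<longrightarrow> (Con C (ss @ t # ts), Con C (ss @ u # ts)) \<in> gt) \<and>
     (\<forall>t u \<theta>. (t, u) \<in> gt \<longrightarrow> sorted_sbst \<Gamma> \<theta> \<longrightarrow> (app_sbst \<theta> t, app_sbst \<theta> u) \<in> gt) \<and>
     (\<forall>t t' u u'. (t, u) \<in> gt \<longrightarrow> (t, t') \<in> AC_cong \<Gamma> E \<longrightarrow> (u, u') \<in> AC_cong \<Gamma> E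
        \<longrightarrow> (t', u') \<in> gt)"

definition confluent_modulo_AC ::
    "('s, 'k, 'c) cdt \<Rightarrow> ('s, 'k, 'c) trm rel \<Rightarrow> ('s, 'k, 'c) trm rel \<Rightarrow> bool" where
  "confluent_modulo_AC \<Gamma> E R \<longleftrightarrow>
     ((AC_step \<Gamma> E R)\<^sup>*)\<inverse> O AC_cong \<Gamma> E O (AC_step \<Gamma> E R)\<^sup>*
     \<subseteq> (AC_step \<Gamma> E R)\<^sup>* O AC_cong \<Gamma> E O ((AC_step \<Gamma> E R)\<^sup>*)\<inverse>"

definition complete_presentation ::
    "('s, 'k, 'c) cdt \<Rightarrow> ('s, 'k, 'c) trm rel \<Rightarrow> ('s, 'k, 'c) trm rel \<Rightarrow> bool" where
  "complete_presentation \<Gamma> E R \<longleftrightarrow>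
     finite R \<and> (\<forall>(l, r)\<in>R. \<exists>\<sigma>. has_sort \<Gamma> \<sigma> l \<and> has_sort \<Gamma> \<sigma> r) \<and>
     (\<exists>gt. AC_reduction_ordering \<Gamma> E gt \<and> R \<subseteq> gt) \<and>
     confluent_modulo_AC \<Gamma> E R \<and>
     eq_cong \<Gamma> E = eq_cong \<Gamma> (R \<union> AC_part E)"

datatype comb = LeftComb | RightComb

definition headed_by :: "'c \<Rightarrow> ('s, 'k, 'c) trm \<Rightarrow> bool" where
  "headed_by C t \<longleftrightarrow> (\<exists>ts. t = Con C ts)"

text \<open>\<open>comb_leaves C k t ls\<close>: the term \<open>t\<close> is a \<open>C\<close>-comb of kind \<open>k\<close> with leaves \<open>ls\<close>.\<close>

inductive comb_leaves ::
    "'c \<Rightarrow> comb \<Rightarrow> ('s, 'k, 'c) trm \<Rightarrow> ('s, 'k, 'c) trm list \<Rightarrow> bool" for C where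
  leaf: "\<not> headed_by C t \<Longrightarrow> comb_leaves C k t [t]"
| right: "\<not> headed_by C t \<Longrightarrow> comb_leaves C RightComb u ls
    \<Longrightarrow> comb_leaves C RightComb (Con C [t, u]) (t # ls)"
| left: "\<not> headed_by C t \<Longrightarrow> comb_leaves C LeftComb u ls
    \<Longrightarrow> comb_leaves C LeftComb (Con C [u, t]) (ls @ [t])"

definition AC_normal_form :: "('s, 'k, 'c) trm rel \<Rightarrow> ('c \<Rightarrow> comb)
    \<Rightarrow> (('s, 'k, 'c) trm \<Rightarrow> ('s, 'k, 'c) trm \<Rightarrow> bool) \<Rightarrow> ('s, 'k, 'c) trm \<Rightarrow> bool" where
  "AC_normal_form E orient le t \<longleftrightarrow>
     (\<forall>s\<in>subterms t. \<forall>C. AC_constr E C \<and> headed_by C s \<longrightarrow>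
        (\<exists>ls. comb_leaves C (orient C) s ls \<and> sorted_wrt le ls)) \<and>
     (\<forall>C u v. Con C [u, v] \<in> subterms t \<and> commutative E C \<and> \<not> AC_constr E C \<longrightarrow> le u v)"

definition total_ordering_on :: "'a set \<Rightarrow> ('a \<Rightarrow> 'a \<Rightarrow> bool) \<Rightarrow> bool" where
  "total_ordering_on A le \<longleftrightarrow>
     reflp_on A le \<and> transp_on A le \<and> antisymp_on A le \<and> totalp_on A le"

type_synonym ('s, 'k, 'c) constr_funs =
  "'c \<Rightarrow> ('s, 'k, 'c) trm list \<Rightarrow> ('s, 'k, 'c) trm"

definition construction_functions ::
    "('s, 'k, 'c) cdt \<Rightarrow> ('s, 'k, 'c) constr_funs \<Rightarrow> bool" where
  "construction_functions \<Gamma> f \<longleftrightarrow>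
     (\<forall>C\<in>constrs \<Gamma>. \<forall>ts. list_all2 (\<lambda>\<sigma> t. t \<in> ground \<Gamma> \<sigma>) (profile \<Gamma> C) ts
        \<longrightarrow> f C ts \<in> ground \<Gamma> (data_sort \<Gamma>))"

inductive is_val :: "('s, 'k, 'c) cdt \<Rightarrow> ('s, 'k, 'c) constr_funs \<Rightarrow> 's
    \<Rightarrow> ('s, 'k, 'c) trm \<Rightarrow> bool" for \<Gamma> f where
  prim: "\<sigma> \<in> prim_sorts \<Gamma> \<Longrightarrow> t \<in> ground \<Gamma> \<sigma> \<Longrightarrow> is_val \<Gamma> f \<sigma> t"
| con: "C \<in> constrs \<Gamma> \<Longrightarrow> list_all2 (is_val \<Gamma> f) (profile \<Gamma> C) vs
    \<Longrightarrow> is_val \<Gamma> f (data_sort \<Gamma>) (f C vs)"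

definition Val :: "('s, 'k, 'c) cdt \<Rightarrow> ('s, 'k, 'c) constr_funs \<Rightarrow> 's
    \<Rightarrow> ('s, 'k, 'c) trm set" where
  "Val \<Gamma> f \<sigma> = {v. is_val \<Gamma> f \<sigma> v}"

definition val_args :: "('s, 'k, 'c) cdt \<Rightarrow> ('s, 'k, 'c) constr_funs \<Rightarrow> 'c
    \<Rightarrow> ('s, 'k, 'c) trm list set" where
  "val_args \<Gamma> f C = {vs. list_all2 (\<lambda>\<sigma> v. v \<in> Val \<Gamma> f \<sigma>) (profile \<Gamma> C) vs}"

definition valid :: "('s, 'k, 'c) cdt \<Rightarrow> ('s, 'k, 'c) trm rel
    \<Rightarrow> ('s, 'k, 'c) constr_funs \<Rightarrow> bool" where
  "valid \<Gamma> E f \<longleftrightarrow>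
     (\<forall>C\<in>constrs \<Gamma>. \<forall>vs\<in>val_args \<Gamma> f C. (f C vs, Con C vs) \<in> eq_cong \<Gamma> E) \<and>
     (\<forall>C\<in>constrs \<Gamma>. \<forall>D\<in>constrs \<Gamma>. \<forall>vs\<in>val_args \<Gamma> f C. \<forall>ws\<in>val_args \<Gamma> f D.
        (Con C vs, Con D ws) \<in> eq_cong \<Gamma> E \<longrightarrow> f C vs = f D ws)"

end

theory Submission
  imports Defs "HOL-Library.Multiset"
begin

text \<open>
  Termination and confluence modulo AC make convertible terms have AC-equivalent normal forms, so
  it remains to see that AC-equivalent ground terms in AC-normal form coincide. For this, every
  term is mapped to a flattened tree in which the arguments of commutative constructors form
  multisets; this tree is invariant under AC-equivalence, and a term in AC-normal form can be
  recovered from it because a multiset has at most one increasing enumeration and a comb is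
  determined by its leaves.
\<close>

section \<open>Sorts and substitutions\<close>

text \<open>The root symbol alone fixes the sort: a variable is tagged with it, a primitive constant
  has its declared sort, and every constructor term has sort \<open>data_sort \<Gamma>\<close>. This
  is what makes \<open>same_sort\<close> transitive.\<close>

lemma has_sort_unique: "has_sort \<Gamma> \<sigma> t \<Longrightarrow> has_sort \<Gamma> \<tau> t \<Longrightarrow> \<sigma> = \<tau>"
  by (cases t) (auto elim: has_sort.cases)

lemma has_sort_ConD:
  assumes "has_sort \<Gamma> \<sigma> (Con C ts)"
  shows "\<sigma> = data_sort \<Gamma> \<and> C \<in> constrs \<Gamma> \<and> list_all2 (has_sort \<Gamma>) (profile \<Gamma> C) ts"
  using assms by (auto elim: has_sort.cases)

lemma app_sbst_Var: "app_sbst Var t = t"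
  by (induction t) (auto intro: map_idI)

text \<open>Substituting only grows a term below its variables, so old positions survive. At a
  variable the only old position is the root, which any term has.\<close>

lemma positions_app_sbst:
  "p \<in> positions t \<Longrightarrow> p \<in> positions (app_sbst \<theta> t) \<and>
    subterm_at (app_sbst \<theta> t) p = app_sbst \<theta> (subterm_at t p) \<and>
    replace_at (app_sbst \<theta> t) p (app_sbst \<theta> s) = app_sbst \<theta> (replace_at t p s)"
proof (induction t arbitrary: p)
  case (Var x \<sigma>)
  then show ?case by (cases "\<theta> x \<sigma>") auto
next
  case (Con C ts)
  then show ?case by (auto simp: map_update)
qed auto

lemma app_sbst_compose:
  "app_sbst \<theta> (app_sbst \<tau> t) = app_sbst (\<lambda>x \<sigma>. app_sbst \<theta> (\<tau> x \<sigma>)) t"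
  by (induction t) auto

lemma has_sort_app_sbst:
  assumes "has_sort \<Gamma> \<sigma> t" "sorted_sbst \<Gamma> \<theta>"
  shows "has_sort \<Gamma> \<sigma> (app_sbst \<theta> t)"
  using assms
proof (induction rule: has_sort.induct)
  case (Con C ts)
  then have "list_all2 (has_sort \<Gamma>) (profile \<Gamma> C) (map (app_sbst \<theta>) ts)"
    by (auto simp: list_all2_conv_all_nth)
  with Con.hyps show ?case by (auto intro: has_sort.Con)
qed (auto simp: sorted_sbst_def intro: has_sort.intros)

lemma well_sorted_app_sbst:
  "t \<in> well_sorted \<Gamma> \<Longrightarrow> sorted_sbst \<Gamma> \<theta> \<Longrightarrow> app_sbst \<theta> t \<in> well_sorted \<Gamma>"
  unfolding well_sorted_def by (auto intro: has_sort_app_sbst)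

text \<open>An ambient relation: the congruences and the rewrite relation are shown to lie inside
  it, which supplies the well-sortedness premises of closure under contexts.\<close>

definition same_sort :: "('s, 'k, 'c) cdt \<Rightarrow> ('s, 'k, 'c) trm rel" where
  "same_sort \<Gamma> = {(t, u). \<exists>\<sigma>. has_sort \<Gamma> \<sigma> t \<and> has_sort \<Gamma> \<sigma> u}"

lemma same_sortD: "(t, u) \<in> same_sort \<Gamma> \<Longrightarrow> has_sort \<Gamma> \<sigma> t \<Longrightarrow> has_sort \<Gamma> \<sigma> u"
  unfolding same_sort_def using has_sort_unique by fast

lemma same_sort_sym: "(t, u) \<in> same_sort \<Gamma> \<Longrightarrow> (u, t) \<in> same_sort \<Gamma>"
  unfolding same_sort_def by auto

lemma same_sort_trans:
  "(t, u) \<in> same_sort \<Gamma> \<Longrightarrow> (u, v) \<in> same_sort \<Gamma> \<Longrightarrow> (t, v) \<in> same_sort \<Gamma>"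
  unfolding same_sort_def using has_sort_unique by fast

lemma same_sort_app_sbst:
  "(t, u) \<in> same_sort \<Gamma> \<Longrightarrow> sorted_sbst \<Gamma> \<theta> \<Longrightarrow> (app_sbst \<theta> t, app_sbst \<theta> u) \<in> same_sort \<Gamma>"
  unfolding same_sort_def using has_sort_app_sbst by fast

lemma same_sort_well_sorted:
  "(t, u) \<in> same_sort \<Gamma> \<Longrightarrow> t \<in> well_sorted \<Gamma> \<and> u \<in> well_sorted \<Gamma>"
  unfolding same_sort_def well_sorted_def by auto

lemma same_sort_Con:
  assumes "(t, u) \<in> same_sort \<Gamma>" "has_sort \<Gamma> \<sigma> (Con C (ss @ t # ts))"
  shows "has_sort \<Gamma> \<sigma> (Con C (ss @ u # ts))"
proof -
  from assms(2) have C: "\<sigma> = data_sort \<Gamma>" "C \<in> constrs \<Gamma>"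
    and l: "list_all2 (has_sort \<Gamma>) (profile \<Gamma> C) (ss @ t # ts)"
    using has_sort_ConD[OF assms(2)] by simp_all
  from l obtain \<sigma>s \<tau> \<tau>s where "profile \<Gamma> C = \<sigma>s @ \<tau> # \<tau>s"
    "list_all2 (has_sort \<Gamma>) \<sigma>s ss" "has_sort \<Gamma> \<tau> t" "list_all2 (has_sort \<Gamma>) \<tau>s ts"
    by (auto simp: list_all2_append2 list_all2_Cons2)
  then have "list_all2 (has_sort \<Gamma>) (profile \<Gamma> C) (ss @ u # ts)"
    using same_sortD[OF assms(1)] by (simp add: list_all2_appendI)
  with C show ?thesis by (auto intro: has_sort.Con)
qed

text \<open>All constructors share the target sort \<open>data_sort \<Gamma>\<close>, so the
  arguments need not be compared.\<close>

lemma Con_same_sort: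
  assumes "Con C ts \<in> well_sorted \<Gamma>" "Con D us \<in> well_sorted \<Gamma>"
  shows "(Con C ts, Con D us) \<in> same_sort \<Gamma>"
proof -
  from assms obtain \<sigma> \<tau> where "has_sort \<Gamma> \<sigma> (Con C ts)" "has_sort \<Gamma> \<tau> (Con D us)"
    by (auto simp: well_sorted_def)
  with has_sort_ConD[OF this(1)] has_sort_ConD[OF this(2)] show ?thesis
    by (auto simp: same_sort_def)
qed

lemma eq_cong_same_sort:
  assumes "G \<subseteq> same_sort \<Gamma>"
  shows "eq_cong \<Gamma> G \<subseteq> same_sort \<Gamma>"
proof (rule subrelI)
  fix t u assume "(t, u) \<in> eq_cong \<Gamma> G"
  then show "(t, u) \<in> same_sort \<Gamma>"
  proof (induction rule: eq_cong.induct)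
    case (sym t u)
    from sym.IH show ?case by (rule same_sort_sym)
  next
    case (trans t u v)
    from trans.IH show ?case by (rule same_sort_trans)
  next
    case (ctxt t u C ss ts)
    from ctxt.hyps(2,3) show ?case by (rule Con_same_sort)
  next
    case (refl t)
    then show ?case by (auto simp: well_sorted_def same_sort_def)
  qed (use assms in \<open>auto intro: same_sort_app_sbst\<close>)
qed

lemma eq_cong_mono:
  assumes "G \<subseteq> H"
  shows "eq_cong \<Gamma> G \<subseteq> eq_cong \<Gamma> H"
proof (rule subrelI)
  fix t u assume "(t, u) \<in> eq_cong \<Gamma> G"
  then show "(t, u) \<in> eq_cong \<Gamma> H"
  proof (induction rule: eq_cong.induct)
    case (sym t u)
    from sym.IH show ?case by (rule eq_cong.sym)
  next
    case (trans t u v)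
    from trans.IH show ?case by (rule eq_cong.trans)
  next
    case (ctxt t u C ss ts)
    from ctxt.IH ctxt.hyps(2,3) show ?case by (rule eq_cong.ctxt)
  qed (use assms in \<open>auto intro: eq_cong.base eq_cong.refl eq_cong.sbst\<close>)
qed

section \<open>Rewriting modulo AC\<close>

text \<open>Closure under one-layer contexts gives closure under replacement at any depth, by
  induction along the position. \<open>X\<close> is left abstract because the congruence, the
  reduction ordering and \<open>same_sort\<close> all take its place later.\<close>

lemma replace_at_closed:
  assumes X: "X \<subseteq> same_sort \<Gamma>"
    and ctxt: "\<And>t u C ss ts. (t, u) \<in> X \<Longrightarrow> Con C (ss @ t # ts) \<in> well_sorted \<Gamma> \<Longrightarrow>
      Con C (ss @ u # ts) \<in> well_sorted \<Gamma> \<Longrightarrow> (Con C (ss @ t # ts), Con C (ss @ u # ts)) \<in> X"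
    and "has_sort \<Gamma> \<sigma> t" "p \<in> positions t" "(subterm_at t p, s) \<in> X"
  shows "(t, replace_at t p s) \<in> X"
  using assms(3-)
proof (induction t p s arbitrary: \<sigma> rule: replace_at.induct)
  case (2 C ts i p s)
  from "2.prems"(2) have i: "i < length ts" "p \<in> positions (ts ! i)" by auto
  from has_sort_ConD[OF "2.prems"(1)] have l: "list_all2 (has_sort \<Gamma>) (profile \<Gamma> C) ts" by simp
  then have "has_sort \<Gamma> (profile \<Gamma> C ! i) (ts ! i)"
    using i by (auto simp: list_all2_conv_all_nth)
  with "2.IH" i "2.prems" have IH: "(ts ! i, replace_at (ts ! i) p s) \<in> X" by auto
  \<comment> \<open>Replacement updates the list at index \<open>i\<close>, while closure under
    contexts speaks of a hole between two lists; splitting \<open>ts\<close> at \<open>i\<close>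
    reconciles them.\<close>
  obtain ss a us where ts: "ts = ss @ a # us" "length ss = i"
    using i(1) by (metis id_take_nth_drop length_take min.absorb4)
  have tsi: "ts ! i = a" using ts by auto
  with IH have a: "(a, replace_at a p s) \<in> X" by simp
  with X "2.prems"(1) ts have "has_sort \<Gamma> \<sigma> (Con C (ss @ replace_at a p s # us))"
    by (auto intro: same_sort_Con[of a])
  then have "(Con C (ss @ a # us), Con C (ss @ replace_at a p s # us)) \<in> X"
    using ctxt[OF a] "2.prems"(1) ts by (auto simp: well_sorted_def)
  then show ?case using ts tsi by auto
qed auto

locale presentation =
  fixes \<Gamma> :: "('s, 'k, 'c) cdt" and E R :: "('s, 'k, 'c) trm rel"
  assumes E_sorted: "E \<subseteq> same_sort \<Gamma>"
    and complete: "complete_presentation \<Gamma> E R"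
begin

abbreviation "step \<equiv> AC_step \<Gamma> E R"
abbreviation "AC \<equiv> AC_cong \<Gamma> E"

lemma R_sorted: "R \<subseteq> same_sort \<Gamma>"
  using complete unfolding complete_presentation_def same_sort_def by auto

lemma AC_sorted: "AC \<subseteq> same_sort \<Gamma>"
  by (rule eq_cong_same_sort) (use E_sorted in \<open>auto simp: AC_part_def\<close>)

lemma eq_cong_R: "eq_cong \<Gamma> E = eq_cong \<Gamma> (R \<union> AC_part E)"
  using complete unfolding complete_presentation_def by auto

lemma AC_stepI:
  assumes "t \<in> well_sorted \<Gamma>" "p \<in> positions t" "(l, r) \<in> R" "sorted_sbst \<Gamma> \<theta>"
    and "(subterm_at t p, app_sbst \<theta> l) \<in> AC"
  shows "(t, replace_at t p (app_sbst \<theta> r)) \<in> step"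
  using assms unfolding AC_step_def by blast

lemma AC_stepE:
  assumes "(t, u) \<in> step"
  obtains p l r \<theta> where "t \<in> well_sorted \<Gamma>" "p \<in> positions t" "(l, r) \<in> R" "sorted_sbst \<Gamma> \<theta>"
    and "(subterm_at t p, app_sbst \<theta> l) \<in> AC" "u = replace_at t p (app_sbst \<theta> r)"
  using assms unfolding AC_step_def by auto

text \<open>The common scheme for bounding the rewrite relation: only a rewrite at the root has to
  be checked, and contexts are handled by \<open>replace_at_closed\<close>.\<close>

lemma step_closed:
  assumes X: "X \<subseteq> same_sort \<Gamma>"
    and ctxt: "\<And>t u C ss ts. (t, u) \<in> X \<Longrightarrow> Con C (ss @ t # ts) \<in> well_sorted \<Gamma> \<Longrightarrow>
      Con C (ss @ u # ts) \<in> well_sorted \<Gamma> \<Longrightarrow> (Con C (ss @ t # ts), Con C (ss @ u # ts)) \<in> X"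
    and redex: "\<And>s l r \<theta>. (s, app_sbst \<theta> l) \<in> AC \<Longrightarrow> (l, r) \<in> R \<Longrightarrow> sorted_sbst \<Gamma> \<theta> \<Longrightarrow>
      (s, app_sbst \<theta> r) \<in> X"
  shows "step \<subseteq> X"
proof (rule subrelI)
  fix t u assume "(t, u) \<in> step"
  then obtain \<sigma> p l r \<theta> where "has_sort \<Gamma> \<sigma> t" "p \<in> positions t" "(l, r) \<in> R" "sorted_sbst \<Gamma> \<theta>"
    "(subterm_at t p, app_sbst \<theta> l) \<in> AC" "u = replace_at t p (app_sbst \<theta> r)"
    by (elim AC_stepE) (auto simp: well_sorted_def)
  then show "(t, u) \<in> X"
    using replace_at_closed[OF X ctxt] redex by blast
qed

lemma redex_sorted:
  assumes "(s, app_sbst \<theta> l) \<in> AC" "(l, r) \<in> R" "sorted_sbst \<Gamma> \<theta>"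
  shows "(s, app_sbst \<theta> r) \<in> same_sort \<Gamma>"
  using assms AC_sorted R_sorted same_sort_app_sbst same_sort_trans by blast

lemma step_sorted: "step \<subseteq> same_sort \<Gamma>"
proof (rule step_closed)
qed (use redex_sorted Con_same_sort in auto)

lemma step_eq_cong: "step \<subseteq> eq_cong \<Gamma> E"
proof -
  \<comment> \<open>With the rules among the generators, a rule is a base pair of the congruence;
    \<open>eq_cong_R\<close> translates back to \<open>E\<close>.\<close>
  have "step \<subseteq> eq_cong \<Gamma> (R \<union> AC_part E)"
  proof (rule step_closed)
    show "eq_cong \<Gamma> (R \<union> AC_part E) \<subseteq> same_sort \<Gamma>"
      using eq_cong_same_sort[OF E_sorted] eq_cong_R by simp
    fix s l r \<theta>
    assume a: "(s, app_sbst \<theta> l) \<in> AC" "(l, r) \<in> R" "sorted_sbst \<Gamma> \<theta>"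
    have "(s, app_sbst \<theta> l) \<in> eq_cong \<Gamma> (R \<union> AC_part E)"
      using a(1) eq_cong_mono[of "AC_part E" "R \<union> AC_part E" \<Gamma>] by auto
    moreover have "(app_sbst \<theta> l, app_sbst \<theta> r) \<in> eq_cong \<Gamma> (R \<union> AC_part E)"
      using a by (auto intro: eq_cong.sbst eq_cong.base)
    ultimately show "(s, app_sbst \<theta> r) \<in> eq_cong \<Gamma> (R \<union> AC_part E)"
      by (rule eq_cong.trans)
  qed (auto intro: eq_cong.ctxt)
  then show ?thesis using eq_cong_R by simp
qed

text \<open>A redex is AC-equivalent to an instance of a left-hand side. Invariance of the ordering
  under AC on its larger side carries the decrease over to the redex itself.\<close>

lemma wf_step: "wf (step\<inverse>)"
proof -
  obtain gt where gt: "AC_reduction_ordering \<Gamma> E gt" "R \<subseteq> gt"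
    using complete unfolding complete_presentation_def by blast
  \<comment> \<open>The ordering may compare terms of different sorts, so it is cut down to the form
    that \<open>step_closed\<close> accepts.\<close>
  have "step \<subseteq> gt \<inter> same_sort \<Gamma>"
  proof (rule step_closed)
    fix s l r \<theta>
    assume a: "(s, app_sbst \<theta> l) \<in> AC" "(l, r) \<in> R" "sorted_sbst \<Gamma> \<theta>"
    note s = redex_sorted[OF a]
    have "(app_sbst \<theta> l, app_sbst \<theta> r) \<in> gt"
      using gt a unfolding AC_reduction_ordering_def by blast
    moreover have "(app_sbst \<theta> l, s) \<in> AC" using a(1) by (rule eq_cong.sym)
    moreover have "(app_sbst \<theta> r, app_sbst \<theta> r) \<in> AC"
      using same_sort_well_sorted[OF s] by (auto intro: eq_cong.refl)
    ultimately have "(s, app_sbst \<theta> r) \<in> gt"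
      using gt(1) unfolding AC_reduction_ordering_def by blast
    with s show "(s, app_sbst \<theta> r) \<in> gt \<inter> same_sort \<Gamma>" by simp
  next
    fix t u C ss ts
    assume a: "(t, u) \<in> gt \<inter> same_sort \<Gamma>" "Con C (ss @ t # ts) \<in> well_sorted \<Gamma>"
      "Con C (ss @ u # ts) \<in> well_sorted \<Gamma>"
    then have "(Con C (ss @ t # ts), Con C (ss @ u # ts)) \<in> gt"
      using gt(1) unfolding AC_reduction_ordering_def by blast
    moreover have "(Con C (ss @ t # ts), Con C (ss @ u # ts)) \<in> same_sort \<Gamma>"
      using a(2,3) by (rule Con_same_sort)
    ultimately show "(Con C (ss @ t # ts), Con C (ss @ u # ts)) \<in> gt \<inter> same_sort \<Gamma>" by simp
  qed auto
  moreover have "wf (gt\<inverse>)" using gt(1) unfolding AC_reduction_ordering_def by simp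
  ultimately show ?thesis by (auto intro: wf_subset)
qed

section \<open>Normal forms and conversion modulo AC\<close>

abbreviation "nf_of \<equiv> R_AC_normal_form_of \<Gamma> E R"

lemma normal_form_exists: "\<exists>u. nf_of u t"
  unfolding R_AC_normal_form_of_def
  using wf_step
proof (induction t rule: wf_induct_rule)
  case (less t)
  show ?case
  proof (cases "t \<in> Domain step")
    case True
    then obtain s where s: "(t, s) \<in> step" by auto
    with less[of s] obtain u where "(s, u) \<in> step\<^sup>*" "u \<notin> Domain step" by auto
    with s show ?thesis by (meson converse_rtrancl_into_rtrancl)
  qed auto
qed

text \<open>Confluence modulo AC closes the peak through \<open>t\<close> and \<open>u\<close>;
  since \<open>t'\<close> and \<open>u'\<close> are irreducible, both descending reductions are
  empty and only the AC link remains.\<close>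

lemma AC_normal_forms:
  assumes "(t, u) \<in> AC" "nf_of t' t" "nf_of u' u"
  shows "(t', u') \<in> AC"
proof -
  have "(t', u') \<in> (step\<^sup>*)\<inverse> O AC O step\<^sup>*"
    using assms unfolding R_AC_normal_form_of_def by auto
  then have "(t', u') \<in> step\<^sup>* O AC O (step\<^sup>*)\<inverse>"
    using complete unfolding complete_presentation_def confluent_modulo_AC_def by blast
  then obtain x y where "(t', x) \<in> step\<^sup>*" "(x, y) \<in> AC" "(u', y) \<in> step\<^sup>*" by auto
  moreover have "t' \<notin> Domain step" "u' \<notin> Domain step"
    using assms unfolding R_AC_normal_form_of_def by auto
  ultimately show ?thesis by (metis Domain.DomainI converse_rtranclE)
qed

lemma step_normal_form: "(t, u) \<in> step \<Longrightarrow> nf_of u' u \<Longrightarrow> nf_of u' t"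
  unfolding R_AC_normal_form_of_def by (auto intro: converse_rtrancl_into_rtrancl)

text \<open>The congruence unrolled into a chain of elementary links, so that normal forms can be
  followed link by link. A whole AC-equivalence counts as one link.\<close>

abbreviation "conv \<equiv> (step \<union> step\<inverse> \<union> AC)\<^sup>*"

lemma conv_sym: "(t, u) \<in> conv \<Longrightarrow> (u, t) \<in> conv"
proof -
  have "sym (step \<union> step\<inverse> \<union> AC)"
    unfolding sym_def using eq_cong.sym by blast
  then show "(t, u) \<in> conv \<Longrightarrow> (u, t) \<in> conv"
    by (meson sym_rtrancl symD)
qed

text \<open>The position and the rule stay the same, the matching substitution is composed with
  \<open>\<tau>\<close>, and AC-equivalence is itself stable under substitution.\<close>

lemma step_app_sbst:
  assumes "(t, u) \<in> step" "sorted_sbst \<Gamma> \<tau>"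
  shows "(app_sbst \<tau> t, app_sbst \<tau> u) \<in> step"
proof -
  from assms(1) obtain p l r \<theta> where t: "t \<in> well_sorted \<Gamma>" and p: "p \<in> positions t"
    and lr: "(l, r) \<in> R" and \<theta>: "sorted_sbst \<Gamma> \<theta>"
    and ac: "(subterm_at t p, app_sbst \<theta> l) \<in> AC" and u: "u = replace_at t p (app_sbst \<theta> r)"
    by (rule AC_stepE)
  let ?\<theta> = "\<lambda>x \<sigma>. app_sbst \<tau> (\<theta> x \<sigma>)"
  have s: "sorted_sbst \<Gamma> ?\<theta>"
    using \<theta> has_sort_app_sbst[OF _ assms(2)] by (simp add: sorted_sbst_def)
  note pos = positions_app_sbst[OF p, of \<tau> "app_sbst \<theta> r"]
  have "(subterm_at (app_sbst \<tau> t) p, app_sbst ?\<theta> l) \<in> AC"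
    using eq_cong.sbst[OF ac assms(2)] pos by (simp add: app_sbst_compose)
  from AC_stepI[OF well_sorted_app_sbst[OF t assms(2)] _ lr s this] pos u show ?thesis
    by (simp add: app_sbst_compose)
qed

lemma step_Con:
  assumes "(t, u) \<in> step" "Con C (ss @ t # ts) \<in> well_sorted \<Gamma>"
  shows "(Con C (ss @ t # ts), Con C (ss @ u # ts)) \<in> step"
proof -
  from assms(1) obtain p l r \<theta> where p: "p \<in> positions t"
    and lr: "(l, r) \<in> R" "sorted_sbst \<Gamma> \<theta>" "(subterm_at t p, app_sbst \<theta> l) \<in> AC"
    and u: "u = replace_at t p (app_sbst \<theta> r)"
    by (rule AC_stepE)
  let ?q = "length ss # p"
  have "?q \<in> positions (Con C (ss @ t # ts))"
    using p by (simp add: nth_append)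
  from AC_stepI[OF assms(2) this lr(1,2)] lr(3) u show ?thesis
    by simp
qed

lemma conv_app_sbst:
  assumes "(t, u) \<in> conv" "sorted_sbst \<Gamma> \<theta>"
  shows "(app_sbst \<theta> t, app_sbst \<theta> u) \<in> conv"
  using assms(1)
proof (induction rule: rtrancl_induct)
  case (step u v)
  then have "(app_sbst \<theta> u, app_sbst \<theta> v) \<in> step \<union> step\<inverse> \<union> AC"
    using step_app_sbst assms(2) by (auto intro: eq_cong.sbst)
  with step.IH show ?case by (rule rtrancl_into_rtrancl)
qed simp

text \<open>Well-sortedness is part of the induction because a link can be lifted into the context
  only between well-sorted terms.\<close>

lemma conv_Con:
  assumes "(t, u) \<in> conv" "Con C (ss @ t # ts) \<in> well_sorted \<Gamma>"
  shows "Con C (ss @ u # ts) \<in> well_sorted \<Gamma> \<and> (Con C (ss @ t # ts), Con C (ss @ u # ts)) \<in> conv"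
  using assms(1)
proof (induction rule: rtrancl_induct)
  case (step u v)
  have "(u, v) \<in> same_sort \<Gamma>"
    using step.hyps(2) step_sorted AC_sorted by (auto intro: same_sort_sym)
  then have v: "Con C (ss @ v # ts) \<in> well_sorted \<Gamma>"
    using step.IH by (auto simp: well_sorted_def intro: same_sort_Con)
  with step have "(Con C (ss @ u # ts), Con C (ss @ v # ts)) \<in> step \<union> step\<inverse> \<union> AC"
    by (auto intro: step_Con eq_cong.ctxt)
  with step.IH v show ?case by (meson rtrancl_into_rtrancl)
qed (use assms(2) in simp)

text \<open>A rule rewrites its own left-hand side at the root, with \<open>Var\<close> as the
  identity substitution.\<close>

lemma rule_step:
  assumes "(l, r) \<in> R"
  shows "(l, r) \<in> step"
proof -
  have l: "l \<in> well_sorted \<Gamma>"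
    using assms R_sorted same_sort_well_sorted by blast
  have s: "sorted_sbst \<Gamma> Var"
    unfolding sorted_sbst_def by (auto intro: has_sort.Var)
  have p: "[] \<in> positions l"
    by (cases l) auto
  have "(subterm_at l [], app_sbst Var l) \<in> AC" "r = replace_at l [] (app_sbst Var r)"
    using l by (auto simp: app_sbst_Var intro: eq_cong.refl)
  with AC_stepI[OF l p assms s] show ?thesis by simp
qed

text \<open>Chains of links satisfy every closure rule of the congruence generated by the rules and
  the AC axioms.\<close>

lemma eq_cong_conv: "eq_cong \<Gamma> E \<subseteq> conv"
  unfolding eq_cong_R
proof (rule subrelI)
  fix t u assume "(t, u) \<in> eq_cong \<Gamma> (R \<union> AC_part E)"
  then show "(t, u) \<in> conv"
  proof (induction rule: eq_cong.induct)
    case (base e)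
    then have "e \<in> step \<union> step\<inverse> \<union> AC"
      using rule_step by (cases e) (auto intro: eq_cong.base)
    then show ?case by (rule r_into_rtrancl)
  next
    case (sym t u)
    from sym.IH show ?case by (rule conv_sym)
  next
    case (trans t u v)
    from trans.IH show ?case by (rule rtrancl_trans)
  qed (auto intro: conv_app_sbst dest: conv_Con)
qed

text \<open>
  Termination is used here besides confluence: transitivity passes through a normal form of the
  middle term.
\<close>

lemma conv_normal_forms:
  assumes "(t, u) \<in> conv" "t \<in> well_sorted \<Gamma>" "nf_of t' t" "nf_of u' u"
  shows "(t', u') \<in> AC"
  using assms(1,4)
proof (induction arbitrary: u' rule: rtrancl_induct)
  case base
  from AC_normal_forms[OF eq_cong.refl[OF assms(2)] assms(3) base] show ?case .
next
  case (step u v)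
  obtain u1 where u1: "nf_of u1 u" using normal_form_exists by blast
  then have t'u1: "(t', u1) \<in> AC" by (rule step.IH)
  consider "(u, v) \<in> step" | "(v, u) \<in> step" | "(u, v) \<in> AC" using step.hyps by auto
  then show ?case
  proof cases
    case 1
    then show ?thesis using step.IH step.prems step_normal_form by blast
  next
    case 2
    then have "(v, v) \<in> AC"
      using step_sorted same_sort_well_sorted by (blast intro: eq_cong.refl)
    then have "(u1, u') \<in> AC"
      using AC_normal_forms step_normal_form[OF 2 u1] step.prems by blast
    with t'u1 show ?thesis by (rule eq_cong.trans)
  next
    case 3
    then have "(u1, u') \<in> AC" using AC_normal_forms u1 step.prems by blast
    with t'u1 show ?thesis by (rule eq_cong.trans)
  qed
qed

text \<open>The Church-Rosser property modulo AC, in the form in which completeness of the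
  construction functions uses it.\<close>

lemma eq_cong_normal_forms:
  assumes "(t, u) \<in> eq_cong \<Gamma> E" "nf_of t' t" "nf_of u' u"
  shows "(t', u') \<in> AC"
proof -
  have "t \<in> well_sorted \<Gamma>"
    using assms(1) eq_cong_same_sort[OF E_sorted] same_sort_well_sorted by blast
  with assms eq_cong_conv conv_normal_forms show ?thesis by blast
qed

lemma normal_form_eq_cong:
  assumes "nf_of u t" "t \<in> well_sorted \<Gamma>"
  shows "(t, u) \<in> eq_cong \<Gamma> E"
proof -
  have "(t, u) \<in> step\<^sup>*" using assms(1) unfolding R_AC_normal_form_of_def by simp
  then show ?thesis
  proof (induction rule: rtrancl_induct)
    case (step u v)
    then have "(u, v) \<in> eq_cong \<Gamma> E" using step_eq_cong by blast
    with step.IH show ?case by (rule eq_cong.trans)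
  qed (rule eq_cong.refl[OF assms(2)])
qed

end

section \<open>Flattened terms\<close>

text \<open>\<open>FMul\<close> forgets the order of arguments. Under an AC-constructor its multiset
  holds the leaves of a whole block of nested occurrences; under a merely commutative one it holds
  the two arguments.\<close>

datatype ('s, 'k, 'c) flat =
    FVar nat 's
  | FPrim 'k
  | FCon 'c "('s, 'k, 'c) flat list"
  | FMul 'c "('s, 'k, 'c) flat multiset"

text \<open>Used to merge a block headed by \<open>C\<close> into an enclosing one, which forgets
  the bracketing.\<close>

primrec flat_leaves :: "'c \<Rightarrow> ('s, 'k, 'c) flat \<Rightarrow> ('s, 'k, 'c) flat multiset" where
  "flat_leaves C (FVar x \<sigma>) = {#FVar x \<sigma>#}"
| "flat_leaves C (FPrim k) = {#FPrim k#}"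
| "flat_leaves C (FCon D as) = {#FCon D as#}"
| "flat_leaves C (FMul D M) = (if D = C then M else {#FMul D M#})"

text \<open>The length test is there because flattening is defined on ill-sorted terms too, whereas
  the commutativity and associativity equations concern binary applications.\<close>

definition flat_con :: "('s, 'k, 'c) trm rel \<Rightarrow> 'c \<Rightarrow> ('s, 'k, 'c) flat list
    \<Rightarrow> ('s, 'k, 'c) flat" where
  "flat_con E C as =
     (if commutative E C \<and> length as = 2
      then FMul C (if AC_constr E C then \<Sum>a\<leftarrow>as. flat_leaves C a else mset as)
      else FCon C as)"

primrec flatten :: "('s, 'k, 'c) trm rel \<Rightarrow> ('s, 'k, 'c) trm \<Rightarrow> ('s, 'k, 'c) flat" where
  "flatten E (Var x \<sigma>) = FVar x \<sigma>"
| "flatten E (Prim k) = FPrim k"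
| "flatten E (Con C ts) = flat_con E C (map (flatten E) ts)"

lemma AC_constr_commutative: "AC_constr E C \<Longrightarrow> commutative E C"
  unfolding AC_constr_def by simp

lemma flat_con_comm:
  assumes "commutative E C"
  shows "flat_con E C [a, b] = flat_con E C [b, a]"
  using assms by (auto simp: flat_con_def add_ac add_mset_commute)

text \<open>Both sides carry the sum of the leaves of \<open>a\<close>, \<open>b\<close> and
  \<open>c\<close>.\<close>

lemma flat_con_assoc:
  assumes "AC_constr E C"
  shows "flat_con E C [flat_con E C [a, b], c] = flat_con E C [a, flat_con E C [b, c]]"
  using assms AC_constr_commutative[OF assms] by (auto simp: flat_con_def add_ac)

text \<open>Quantifying over all instances makes the invariant stable under substitution.\<close>

lemma AC_cong_flatten_app_sbst:
  assumes "(t, u) \<in> AC_cong \<Gamma> E"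
  shows "flatten E (app_sbst \<theta> t) = flatten E (app_sbst \<theta> u)"
  using assms
proof (induction "(t, u)" arbitrary: t u \<theta> rule: eq_cong.induct)
  case base
  then obtain C where C: "(t, u) \<in> E" "commutative E C" "comm_eq C (t, u) \<or> assoc_eq C (t, u)"
    by (auto simp: AC_part_def)
  show ?case
  proof (cases "comm_eq C (t, u)")
    case True
    then show ?thesis using flat_con_comm[OF C(2)] by (auto simp: comm_eq_def)
  next
    case False
    with C have "assoc_eq C (t, u)" "AC_constr E C" by (auto simp: AC_constr_def)
    then show ?thesis using flat_con_assoc[OF \<open>AC_constr E C\<close>] by (auto simp: assoc_eq_def)
  qed
next
  case (sbst t u \<tau>)
  show ?case unfolding app_sbst_compose by (rule sbst.hyps)
qed auto

lemma AC_cong_flatten: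
  assumes "(t, u) \<in> AC_cong \<Gamma> E"
  shows "flatten E t = flatten E u"
  using AC_cong_flatten_app_sbst[OF assms, of Var] by (simp add: app_sbst_Var)

section \<open>Combs seen through flattening\<close>

lemma flatten_headed:
  assumes "flatten E t = flatten E (Con C ss)"
  shows "headed_by C t"
  using assms by (cases t) (auto simp: flat_con_def headed_by_def split: if_splits)

lemma flat_leaves_not_headed:
  assumes "\<not> headed_by C t"
  shows "flat_leaves C (flatten E t) = {#flatten E t#}"
  using assms by (cases t) (auto simp: flat_con_def headed_by_def)

text \<open>Each layer of a comb adds one leaf not headed by \<open>C\<close>, which contributes a
  singleton. Left and right combs are treated alike because a multiset ignores the order.\<close>

lemma comb_leaves_flatten:
  assumes "comb_leaves C k t ls" "AC_constr E C"
  shows "flat_leaves C (flatten E t) = mset (map (flatten E) ls)"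
  using assms AC_constr_commutative[OF assms(2)]
  by (induction rule: comb_leaves.induct) (auto simp: flat_leaves_not_headed flat_con_def)

lemma comb_leaves_not_Nil: "comb_leaves C k t ls \<Longrightarrow> ls \<noteq> []"
  by (induction rule: comb_leaves.induct) auto

text \<open>The shared kind \<open>k\<close> tells at which end of the list the outermost leaf sits.
  A proper comb has at least two leaves, so it cannot be confused with a single leaf; this is where
  \<open>comb_leaves_not_Nil\<close> enters.\<close>

lemma comb_leaves_unique:
  assumes "comb_leaves C k t ls" "comb_leaves C k u ls"
  shows "t = u"
  using assms
proof (induction arbitrary: u rule: comb_leaves.induct)
  case (leaf t k)
  from leaf.prems show ?case
    by (cases rule: comb_leaves.cases) (auto dest: comb_leaves_not_Nil)
next
  case (right t v ls)
  from right.prems right.hyps show ?case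
    by (cases rule: comb_leaves.cases) (auto intro: right.IH dest: comb_leaves_not_Nil)
next
  case (left t v ls)
  from left.prems left.hyps show ?case
    by (cases rule: comb_leaves.cases) (auto intro: left.IH dest: comb_leaves_not_Nil)
qed

section \<open>Terms in AC-normal form\<close>

text \<open>Turns the definition by positions into a recursion that structural induction can
  use.\<close>

lemma subterms_Con: "subterms (Con C ts) = insert (Con C ts) (\<Union>t\<in>set ts. subterms t)"
proof -
  have "positions (Con C ts) = insert [] (\<Union>i<length ts. (#) i ` positions (ts ! i))"
    by auto
  then have "subterms (Con C ts) = insert (Con C ts) (\<Union>i<length ts. subterms (ts ! i))"
    unfolding subterms_def by (simp add: image_UN image_image)
  then show ?thesis
    by (simp add: set_conv_nth image_Collect) blast
qed

lemma subterms_self: "t \<in> subterms t"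
  by (cases t) (auto simp: subterms_Con, auto simp: subterms_def)

lemma subterms_trans: "s \<in> subterms t \<Longrightarrow> subterms s \<subseteq> subterms t"
proof (induction t)
  case (Con C ts)
  then show ?case by (auto simp: subterms_Con)
qed (auto simp: subterms_def)

lemma subterms_size: "s \<in> subterms t \<Longrightarrow> s = t \<or> size s < size t"
proof (induction t)
  case (Con C ts)
  show ?case
  proof (cases "s = Con C ts")
    case False
    then obtain t where t: "t \<in> set ts" "s \<in> subterms t"
      using Con.prems by (auto simp: subterms_Con)
    then have "size s \<le> size t" using Con.IH by fastforce
    also have "size t < size (Con C ts)"
      using size_list_estimation'[OF t(1) order_refl, of size] by simp
    finally show ?thesis by simp
  qed simp
qed (auto simp: subterms_def)

text \<open>The union over all sorts is taken because an argument may have a primitive sort.\<close>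

lemma ground_subterms:
  "s \<in> subterms t \<Longrightarrow> t \<in> (\<Union>\<sigma>. ground \<Gamma> \<sigma>) \<Longrightarrow> s \<in> (\<Union>\<sigma>. ground \<Gamma> \<sigma>)"
proof (induction t)
  case (Con C ts)
  show ?case
  proof (cases "s = Con C ts")
    case False
    then obtain t where t: "t \<in> set ts" "s \<in> subterms t"
      using Con.prems by (auto simp: subterms_Con)
    from Con.prems have "list_all2 (has_sort \<Gamma>) (profile \<Gamma> C) ts" "vars (Con C ts) = {}"
      by (auto simp: ground_def dest: has_sort_ConD)
    then have "t \<in> (\<Union>\<sigma>. ground \<Gamma> \<sigma>)"
      using t(1) by (auto simp: ground_def list_all2_conv_all_nth in_set_conv_nth)
    with Con.IH t show ?thesis by blast
  qed (use Con.prems in simp)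
qed (auto simp: subterms_def)

lemma AC_normal_form_subterms:
  "AC_normal_form E orient le t \<Longrightarrow> s \<in> subterms t \<Longrightarrow> AC_normal_form E orient le s"
  using subterms_trans[of s t] unfolding AC_normal_form_def by (meson subsetD)

lemma comb_leaves_subterms:
  assumes "comb_leaves C k t ls" "s \<in> set ls"
  shows "s \<in> subterms t \<and> \<not> headed_by C s"
  using assms by (induction rule: comb_leaves.induct) (auto simp: subterms_Con subterms_self)

text \<open>If the two heads differed, each would occur in the tail of the other list, hence each
  would be below the other, against antisymmetry.\<close>

lemma sorted_wrt_mset_unique:
  assumes "antisymp_on A le" "set xs \<subseteq> A" "sorted_wrt le xs" "sorted_wrt le ys" "mset xs = mset ys"
  shows "xs = ys"
  using assms(2-)
proof (induction xs arbitrary: ys)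
  case (Cons x xs)
  then obtain y ys' where ys: "ys = y # ys'" by (cases ys) auto
  have set: "set (x # xs) = set ys" using Cons.prems(4) mset_eq_setD by blast
  have "x = y"
  proof (rule ccontr)
    assume "x \<noteq> y"
    with set ys have "x \<in> set ys'" "y \<in> set xs" by auto
    with Cons.prems ys have "le x y" "le y x" by auto
    moreover have "x \<in> A" "y \<in> A" using Cons.prems(1) set ys by auto
    ultimately show False using assms(1) \<open>x \<noteq> y\<close> by (meson antisymp_onD)
  qed
  with Cons ys show ?case by auto
qed auto

text \<open>Induction on size rather than on structure, since the leaves of a comb may lie deep
  below its root. By induction flattening is injective on leaves or arguments, so their multiset is
  recovered; sortedness then fixes their order, and the comb shape fixes the term.\<close>

lemma flatten_inj:
  assumes "antisymp_on (\<Union>\<sigma>. ground \<Gamma> \<sigma>) le"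
    and "AC_normal_form E orient le t" "AC_normal_form E orient le u"
    and "t \<in> (\<Union>\<sigma>. ground \<Gamma> \<sigma>)" "u \<in> (\<Union>\<sigma>. ground \<Gamma> \<sigma>)"
    and "flatten E t = flatten E u"
  shows "t = u"
  using assms(2-)
proof (induction "size t" arbitrary: t u rule: less_induct)
  case less
  \<comment> \<open>The induction hypothesis for pairs of subterms. The measure is the size of
    \<open>t\<close> alone, so only \<open>x\<close> has to be proper.\<close>
  have sub: "x = y" if "x \<in> subterms t" "y \<in> subterms u" "flatten E x = flatten E y" "x \<noteq> t" for x y
  proof (rule less.hyps)
    show "size x < size t" using subterms_size[OF that(1)] that(4) by blast
    show "AC_normal_form E orient le x" "AC_normal_form E orient le y"
      using AC_normal_form_subterms less.prems(1,2) that(1,2) by blast+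
    show "x \<in> (\<Union>\<sigma>. ground \<Gamma> \<sigma>)" by (rule ground_subterms[OF that(1) less.prems(3)])
    show "y \<in> (\<Union>\<sigma>. ground \<Gamma> \<sigma>)" by (rule ground_subterms[OF that(2) less.prems(4)])
  qed (rule that(3))
  show ?case
  proof (cases t)
    case (Var x \<sigma>)
    with less.prems show ?thesis by (auto simp: ground_def)
  next
    case (Prim k)
    with less.prems(5) show ?thesis by (cases u) (auto simp: flat_con_def split: if_splits)
  next
    case (Con C ts)
    then have "headed_by C u" using less.prems(5) flatten_headed by metis
    then obtain us where u: "u = Con C us" by (auto simp: headed_by_def)
    have args: "x = y" if "x \<in> set ts" "y \<in> set us" "flatten E x = flatten E y" for x y
    proof -
      have "x \<noteq> t"
        using that(1) size_list_estimation'[OF that(1) order_refl, of size] Con by auto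
      moreover have "x \<in> subterms t" "y \<in> subterms u"
        using that Con u by (auto simp: subterms_Con intro: subterms_self)
      ultimately show ?thesis using sub that(3) by blast
    qed
    \<comment> \<open>The cases follow the branches of \<open>flat_con\<close>. The first carries no
      length condition, as the comb shape already forces binary applications; the last is the one
      where \<open>flat_con\<close> keeps the argument list.\<close>
    consider "AC_constr E C" | "commutative E C" "\<not> AC_constr E C" "length ts = 2"
      | "\<not> AC_constr E C" "\<not> (commutative E C \<and> length ts = 2)"
      by blast
    then show ?thesis
    proof cases
      case 1
      have headed: "headed_by C t" "headed_by C u" using Con u by (auto simp: headed_by_def)
      obtain ls where ls: "comb_leaves C (orient C) t ls" "sorted_wrt le ls"
        using less.prems(1) 1 headed(1) subterms_self[of t] unfolding AC_normal_form_def by blast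
      obtain ms where ms: "comb_leaves C (orient C) u ms" "sorted_wrt le ms"
        using less.prems(2) 1 headed(2) subterms_self[of u] unfolding AC_normal_form_def by blast
      have "mset (map (flatten E) ls) = mset (map (flatten E) ms)"
        using comb_leaves_flatten[OF ls(1) 1] comb_leaves_flatten[OF ms(1) 1] less.prems(5) by simp
      then have "image_mset (flatten E) (mset ls) = image_mset (flatten E) (mset ms)" by simp
      then have "mset ls = mset ms"
      \<comment> \<open>Leaves are not headed by \<open>C\<close> while \<open>t\<close> is, so
        every leaf of \<open>t\<close> is a proper subterm and \<open>sub\<close> applies.\<close>
      proof (rule multiset.inj_map_strong[rotated])
        fix x y
        assume xy: "x \<in># mset ls" "y \<in># mset ms" "flatten E x = flatten E y"
        then have "x \<in> subterms t" "y \<in> subterms u" "\<not> headed_by C x"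
          using comb_leaves_subterms[OF ls(1)] comb_leaves_subterms[OF ms(1)] by auto
        with sub[of x y] xy(3) headed(1) show "x = y" by blast
      qed
      moreover have "set ls \<subseteq> (\<Union>\<sigma>. ground \<Gamma> \<sigma>)"
        using comb_leaves_subterms[OF ls(1)] ground_subterms[OF _ less.prems(3)] by blast
      ultimately have "ls = ms"
        using sorted_wrt_mset_unique[OF assms(1)] ls(2) ms(2) by blast
      with ls(1) ms(1) show ?thesis by (auto intro: comb_leaves_unique)
    next
      case 2
      with less.prems(5) Con u have "length us = 2"
        and "image_mset (flatten E) (mset ts) = image_mset (flatten E) (mset us)"
        by (auto simp: flat_con_def split: if_splits)
      from this(2) have "mset ts = mset us"
        by (rule multiset.inj_map_strong[rotated]) (use args in auto)
      obtain a b c d where ab: "ts = [a, b]" "us = [c, d]"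
        using 2 \<open>length us = 2\<close> by (auto simp: numeral_2_eq_2 length_Suc_conv)
      have "le a b" "le c d"
        using less.prems(1,2) 2 subterms_self[of t] subterms_self[of u] Con u ab
        unfolding AC_normal_form_def by blast+
      then have "sorted_wrt le ts" "sorted_wrt le us" by (simp_all add: ab)
      moreover have "set ts \<subseteq> (\<Union>\<sigma>. ground \<Gamma> \<sigma>)"
      proof
        fix x assume "x \<in> set ts"
        then have "x \<in> subterms t" using Con by (auto simp: subterms_Con intro: subterms_self)
        then show "x \<in> (\<Union>\<sigma>. ground \<Gamma> \<sigma>)" using less.prems(3) by (rule ground_subterms)
      qed
      ultimately have "ts = us"
        using sorted_wrt_mset_unique[OF assms(1)] \<open>mset ts = mset us\<close> by blast
      with Con u show ?thesis by simp
    next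
      case 3
      with less.prems(5) Con u have "map (flatten E) ts = map (flatten E) us"
        by (auto simp: flat_con_def split: if_splits)
      then have "ts = us"
        by (rule list.inj_map_strong[rotated]) (use args in auto)
      with Con u show ?thesis by simp
    qed
  qed
qed

section \<open>Values\<close>

lemma val_ground:
  assumes "construction_functions \<Gamma> f" "is_val \<Gamma> f \<sigma> v"
  shows "v \<in> ground \<Gamma> \<sigma>"
  using assms(2)
proof (induction rule: is_val.induct)
  case (con C vs)
  then have "list_all2 (\<lambda>\<sigma> t. t \<in> ground \<Gamma> \<sigma>) (profile \<Gamma> C) vs"
    by (simp add: list_all2_conv_all_nth)
  with con.hyps assms(1) show ?case unfolding construction_functions_def by blast
qed

lemma val_args_ground:
  assumes "construction_functions \<Gamma> f" "vs \<in> val_args \<Gamma> f C"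
  shows "list_all2 (\<lambda>\<sigma> t. t \<in> ground \<Gamma> \<sigma>) (profile \<Gamma> C) vs"
  using assms(2) val_ground[OF assms(1)]
  by (simp add: val_args_def Val_def list_all2_conv_all_nth)

lemma Con_val_args_well_sorted:
  assumes "construction_functions \<Gamma> f" "C \<in> constrs \<Gamma>" "vs \<in> val_args \<Gamma> f C"
  shows "Con C vs \<in> well_sorted \<Gamma>"
proof -
  have "list_all2 (has_sort \<Gamma>) (profile \<Gamma> C) vs"
    using val_args_ground[OF assms(1,3)] by (simp add: ground_def list_all2_conv_all_nth)
  with assms(2) show ?thesis unfolding well_sorted_def by (auto intro: has_sort.Con)
qed

theorem theorem5:
  fixes \<Gamma> :: "('s, 'k, 'c) cdt"
    and E R :: "('s, 'k, 'c) trm rel"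
    and orient :: "'c \<Rightarrow> comb"
    and le :: "('s, 'k, 'c) trm \<Rightarrow> ('s, 'k, 'c) trm \<Rightarrow> bool"
    and f :: "('s, 'k, 'c) constr_funs"
  assumes "cdt_definition \<Gamma>"
    and "finite E"
    and "\<forall>(l, r)\<in>E. has_sort \<Gamma> (data_sort \<Gamma>) l \<and> has_sort \<Gamma> (data_sort \<Gamma>) r"
    and "complete_presentation \<Gamma> E R"
    and "total_ordering_on (\<Union>\<sigma>. ground \<Gamma> \<sigma>) le"
    and "construction_functions \<Gamma> f"
    and "\<And>C vs. C \<in> constrs \<Gamma> \<Longrightarrow> vs \<in> val_args \<Gamma> f C \<Longrightarrow>
           R_AC_normal_form_of \<Gamma> E R (f C vs) (Con C vs) \<and>
           AC_normal_form E orient le (f C vs)"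
  shows "valid \<Gamma> E f"
proof -
  interpret presentation \<Gamma> E R
    by unfold_locales (use assms(3,4) in \<open>auto simp: same_sort_def\<close>)
  have antisym: "antisymp_on (\<Union>\<sigma>. ground \<Gamma> \<sigma>) le"
    using assms(5) unfolding total_ordering_on_def by simp
  have ground: "f C vs \<in> (\<Union>\<sigma>. ground \<Gamma> \<sigma>)" if "C \<in> constrs \<Gamma>" "vs \<in> val_args \<Gamma> f C" for C vs
    using assms(6) that(1) val_args_ground[OF assms(6) that(2)]
    unfolding construction_functions_def by blast
  show ?thesis
    unfolding valid_def
  proof (intro conjI ballI impI)
    fix C vs assume C: "C \<in> constrs \<Gamma>" "vs \<in> val_args \<Gamma> f C"
    have "(Con C vs, f C vs) \<in> eq_cong \<Gamma> E"
      using assms(7)[OF C] Con_val_args_well_sorted[OF assms(6) C] by (auto intro: normal_form_eq_cong)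
    then show "(f C vs, Con C vs) \<in> eq_cong \<Gamma> E" by (rule eq_cong.sym)
  next
    fix C D vs ws
    assume C: "C \<in> constrs \<Gamma>" and D: "D \<in> constrs \<Gamma>"
      and vs: "vs \<in> val_args \<Gamma> f C" and ws: "ws \<in> val_args \<Gamma> f D"
      and eq: "(Con C vs, Con D ws) \<in> eq_cong \<Gamma> E"
    have "(f C vs, f D ws) \<in> AC"
      using assms(7)[OF C vs] assms(7)[OF D ws] by (auto intro: eq_cong_normal_forms[OF eq])
    then have "flatten E (f C vs) = flatten E (f D ws)" by (rule AC_cong_flatten)
    then show "f C vs = f D ws"
      using flatten_inj[OF antisym _ _ ground[OF C vs] ground[OF D ws]] assms(7)[OF C vs]
        assms(7)[OF D ws] by blast
  qed
qed

end
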